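(* Let $D$ be a diagram. If $\tilde E_c(D)\ne0$, then for every row index $r\ge1$, $\tilde e_r(D)\ne0$ if and only if $\tilde e_r(\tilde E_c(D))\neq0$. Likewise, if $\tilde e_r(D)\neq0$, then for every column index $c\ge1$, $\tilde E_c(D)\neq0$ if and only if $\tilde E_c(\tilde e_r(D))\neq0$. Moreover, $\tilde E_c(\tilde e_r(D))=\tilde e_r(\tilde E_c(D))$ whenever $\tilde E_c(D)\neq0$ and $\tilde e_r(D)\ne0$.
   Context: A diagram is a finite set of cells $(r,c)$ with $r,c\ge1$ (row $r$, column $c$). Vertical $i$-pairing: pair cells in rows $i$ and $i+1$ lying in the same column; then iteratively pair an unpaired cell in row $i+1$ with an unpaired cell in row $i$ in a column to its left whenever all cells of rows $i$ and $i+1$ in the columns between them are already paired. The raising operator $\tilde e_i$ moves the rightmost vertically unpaired cell of row $i+1$ down to row $i$ (same column), and $\tilde e_i(D)=0$ if row $i+1$ has no vertically unpaired cell. Horizontal $i$-pairing: pair cells in columns $i$ and $i+1$ lying in the same row; then iteratively pair an unpaired cell in column $i+1$ with an unpaired cell in column $i$ in a row above it whenever all cells of columns $i$ and $i+1$ in the rows between them are already paired. The rectification operator $\tilde E_i$ moves the bottom-most horizontally unpaired cell of column $i+1$ left to column $i$ (same row), and $\tilde E_i(D)=0$ if column $i+1$ has no horizontally unpaired cell. *)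

theory Defs
  imports Main
begin

text \<open>
  A cell is a pair (row, column).  Rows are numbered upwards (row \<open>i\<close> lies directly below
  row \<open>i + 1\<close>) and columns from left to right; so ``above'' means a larger row index,
  and ``bottom-most'' means the smallest row index.
\<close>

type_synonym cell = "nat \<times> nat"
type_synonym diagram = "cell set"

definition is_diagram :: "diagram \<Rightarrow> bool" where
  "is_diagram D \<longleftrightarrow> finite D \<and> (\<forall>(r, c) \<in> D. 1 \<le> r \<and> 1 \<le> c)"

definition matched :: "(cell \<times> cell) set \<Rightarrow> cell set" where
  "matched P = fst ` P \<union> snd ` P"

text \<open>
  The pairings are built in rounds.  Each pair lists first the cell of row (column) \<open>i + 1\<close>,
  then the cell of row (column) \<open>i\<close>.  Round \<open>0\<close> makes the pairs within a common column (row);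
  each later round adds every pair that the iteration rule allows at that moment.
  Two such pairs never share a cell: if one cell were eligible with two different partners, the
  nearer partner would be an unpaired cell between the given cell and the farther partner.
\<close>

primrec vert_pairs :: "nat \<Rightarrow> diagram \<Rightarrow> nat \<Rightarrow> (cell \<times> cell) set" where
  "vert_pairs i D 0 = {((i + 1, c), (i, c)) |c. (i + 1, c) \<in> D \<and> (i, c) \<in> D}"
| "vert_pairs i D (Suc n) = vert_pairs i D n \<union>
     {((i + 1, c), (i, b)) |b c. b < c
        \<and> (i + 1, c) \<in> D - matched (vert_pairs i D n)
        \<and> (i, b) \<in> D - matched (vert_pairs i D n)
        \<and> (\<forall>r \<in> {i, i + 1}. \<forall>k \<in> {b<..<c}. (r, k) \<in> D \<longrightarrow> (r, k) \<in> matched (vert_pairs i D n))}"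

definition vert_pairing :: "nat \<Rightarrow> diagram \<Rightarrow> (cell \<times> cell) set" where
  "vert_pairing i D = (\<Union>n. vert_pairs i D n)"

primrec horiz_pairs :: "nat \<Rightarrow> diagram \<Rightarrow> nat \<Rightarrow> (cell \<times> cell) set" where
  "horiz_pairs i D 0 = {((r, i + 1), (r, i)) |r. (r, i + 1) \<in> D \<and> (r, i) \<in> D}"
| "horiz_pairs i D (Suc n) = horiz_pairs i D n \<union>
     {((r, i + 1), (s, i)) |r s. r < s
        \<and> (r, i + 1) \<in> D - matched (horiz_pairs i D n)
        \<and> (s, i) \<in> D - matched (horiz_pairs i D n)
        \<and> (\<forall>c \<in> {i, i + 1}. \<forall>k \<in> {r<..<s}. (k, c) \<in> D \<longrightarrow> (k, c) \<in> matched (horiz_pairs i D n))}"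

definition horiz_pairing :: "nat \<Rightarrow> diagram \<Rightarrow> (cell \<times> cell) set" where
  "horiz_pairing i D = (\<Union>n. horiz_pairs i D n)"

text \<open>
  The value \<open>0\<close> of an operator is \<open>None\<close>; it is distinct from the empty diagram \<open>Some {}\<close>.
\<close>

definition raising :: "nat \<Rightarrow> diagram \<Rightarrow> diagram option" where
  "raising i D =
     (let U = {c. (i + 1, c) \<in> D - matched (vert_pairing i D)}
      in if U = {} then None
         else Some (insert (i, Max U) (D - {(i + 1, Max U)})))"

definition rectify :: "nat \<Rightarrow> diagram \<Rightarrow> diagram option" where
  "rectify i D =
     (let U = {r. (r, i + 1) \<in> D - matched (horiz_pairing i D)}
      in if U = {} then None
         else Some (insert (Min U, i) (D - {(Min U, i + 1)})))"

end

theory Submission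
  imports Defs
begin

text \<open>
  By the signature rule, the rightmost unpaired cell of row \<open>r + 1\<close> sits in the column where the
  walk \<open>k \<mapsto> #(row r, columns < k) - #(row r + 1, columns < k)\<close> makes the step to its first minimum,
  and \<open>e\<^sub>r\<close> annihilates \<open>D\<close> iff this walk is nonnegative.  Dually, the bottom-most unpaired cell of
  column \<open>c + 1\<close> sits at the last maximum of the analogous walk for columns \<open>c\<close> and \<open>c + 1\<close>, read
  upwards.  Applying \<open>E\<^sub>c\<close> changes the row walk at the single argument \<open>c + 1\<close>, by at most one, and
  \<open>e\<^sub>r\<close> changes the column walk only at \<open>r + 1\<close>.  Extremality of the two walks restricts the four
  cells in rows \<open>r, r + 1\<close> and columns \<open>c, c + 1\<close> so much that the extremal values survive and the
  selected cells are unaffected, except in two configurations inside this square, where both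
  compositions move two cells around the square to the same result.
\<close>

section \<open>Bracketing in a linear order\<close>

text \<open>
  Elements of \<open>A\<close> are opening brackets and elements of \<open>B\<close> closing brackets; a pair lists the closing
  bracket first.  The order stays a parameter because columns are read from left to right, but rows
  from top to bottom.
\<close>

locale bracketing = linorder less_eq less
  for less_eq :: "'a \<Rightarrow> 'a \<Rightarrow> bool" (infix "\<sqsubseteq>" 50) and less (infix "\<sqsubset>" 50) +
  fixes A B :: "'a set"
  assumes finite_A: "finite A" and finite_B: "finite B"
begin

primrec pairs :: "nat \<Rightarrow> ('a \<times> 'a) set" where
  "pairs 0 = {(x, x) |x. x \<in> B \<and> x \<in> A}"
| "pairs (Suc n) = pairs n \<union> {(p, b) |p b. b \<sqsubset> p
     \<and> p \<in> B - Domain (pairs n) \<and> b \<in> A - Range (pairs n)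
     \<and> (\<forall>x. b \<sqsubset> x \<and> x \<sqsubset> p \<longrightarrow>
          (x \<in> A \<longrightarrow> x \<in> Range (pairs n)) \<and> (x \<in> B \<longrightarrow> x \<in> Domain (pairs n)))}"

definition pairing :: "('a \<times> 'a) set" where
  "pairing = (\<Union>n. pairs n)"

text \<open>Invariant of the rounds, strong enough for the counting argument below. Maximality is
  absent because it may fail before the last effective round.\<close>

definition noncrossing_matching :: "('a \<times> 'a) set \<Rightarrow> bool" where
  "noncrossing_matching P \<longleftrightarrow>
     (\<forall>p b. (p, b) \<in> P \<longrightarrow> p \<in> B \<and> b \<in> A \<and> b \<sqsubseteq> p) \<and>
     (\<forall>x \<in> A \<inter> B. (x, x) \<in> P) \<and>
     single_valued P \<and> single_valued (P\<inverse>) \<and>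
     (\<forall>p b x. (p, b) \<in> P \<and> b \<sqsubset> x \<and> x \<sqsubset> p \<longrightarrow>
        (x \<in> A \<longrightarrow> x \<in> Range P) \<and> (x \<in> B \<longrightarrow> x \<in> Domain P)) \<and>
     (\<forall>p b p' b'. (p, b) \<in> P \<and> (p', b') \<in> P \<and> b \<sqsubset> b' \<and> b' \<sqsubset> p \<longrightarrow> p' \<sqsubset> p)"

lemma pairs_mono: "m \<le> n \<Longrightarrow> pairs m \<subseteq> pairs n"
  by (induction rule: dec_induct) auto

lemma noncrossing_matchingD:
  assumes "noncrossing_matching P"
  shows "(p, b) \<in> P \<Longrightarrow> p \<in> B \<and> b \<in> A \<and> b \<sqsubseteq> p"
    and "x \<in> A \<Longrightarrow> x \<in> B \<Longrightarrow> (x, x) \<in> P"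
    and "(p, b) \<in> P \<Longrightarrow> (p, b') \<in> P \<Longrightarrow> b = b'"
    and "(p, b) \<in> P \<Longrightarrow> (p', b) \<in> P \<Longrightarrow> p = p'"
    and "(p, b) \<in> P \<Longrightarrow> b \<sqsubset> x \<Longrightarrow> x \<sqsubset> p \<Longrightarrow>
      (x \<in> A \<longrightarrow> x \<in> Range P) \<and> (x \<in> B \<longrightarrow> x \<in> Domain P)"
    and "(p, b) \<in> P \<Longrightarrow> (p', b') \<in> P \<Longrightarrow> b \<sqsubset> b' \<Longrightarrow> b' \<sqsubset> p \<Longrightarrow> p' \<sqsubset> p"
  using assms unfolding noncrossing_matching_def single_valued_def
  by (simp, simp, blast, blast, blast, blast)

text \<open>Everything strictly inside a new pair was paired in earlier rounds, so a new pair can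
  neither share an endpoint with another pair nor cross one.\<close>

lemma noncrossing_matching_pairs: "noncrossing_matching (pairs n)"
proof (induction n)
  case 0
  show ?case
    by (auto simp: noncrossing_matching_def single_valued_def)
next
  case (Suc n)
  define P where "P = pairs n"
  define N where "N = {(p, b) |p b. b \<sqsubset> p \<and> p \<in> B - Domain P \<and> b \<in> A - Range P
     \<and> (\<forall>x. b \<sqsubset> x \<and> x \<sqsubset> p \<longrightarrow>
          (x \<in> A \<longrightarrow> x \<in> Range P) \<and> (x \<in> B \<longrightarrow> x \<in> Domain P))}"
  have IH: "noncrossing_matching P" using Suc by (simp add: P_def)
  note ends = noncrossing_matchingD(1)[OF IH]
    and diag = noncrossing_matchingD(2)[OF IH]
    and sv = noncrossing_matchingD(3)[OF IH]
    and sv' = noncrossing_matchingD(4)[OF IH]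
    and inner = noncrossing_matchingD(5)[OF IH]
    and cross = noncrossing_matchingD(6)[OF IH]
  have N: "b \<sqsubset> p" "p \<in> B" "p \<notin> Domain P" "b \<in> A" "b \<notin> Range P"
    "\<And>x. b \<sqsubset> x \<Longrightarrow> x \<sqsubset> p \<Longrightarrow>
       (x \<in> A \<longrightarrow> x \<in> Range P) \<and> (x \<in> B \<longrightarrow> x \<in> Domain P)"
    if "(p, b) \<in> N" for p b
    using that by (auto simp: N_def)
  \<comment> \<open>Of two distinct partners the nearer one would lie inside the longer pair, hence
    would already be paired.\<close>
  have Nsv: "b = b'" if "(p, b) \<in> N" "(p, b') \<in> N" for p b b'
  proof (rule linorder_cases[of b b'])
    show "b = b'" if "b \<sqsubset> b'" using N(6)[OF \<open>(p, b) \<in> N\<close> that] N[OF \<open>(p, b') \<in> N\<close>] by blast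
    show "b = b'" if "b' \<sqsubset> b" using N(6)[OF \<open>(p, b') \<in> N\<close> that] N[OF \<open>(p, b) \<in> N\<close>] by blast
  qed
  have Nsv': "p = p'" if "(p, b) \<in> N" "(p', b) \<in> N" for p p' b
  proof (rule linorder_cases[of p p'])
    show "p = p'" if "p \<sqsubset> p'" using N(6)[OF \<open>(p', b) \<in> N\<close> _ that] N[OF \<open>(p, b) \<in> N\<close>] by blast
    show "p = p'" if "p' \<sqsubset> p" using N(6)[OF \<open>(p, b) \<in> N\<close> _ that] N[OF \<open>(p', b) \<in> N\<close>] by blast
  qed
  have "noncrossing_matching (P \<union> N)"
    unfolding noncrossing_matching_def
  proof (intro conjI allI ballI impI)
    fix p b assume "(p, b) \<in> P \<union> N"
    then show "p \<in> B" "b \<in> A" "b \<sqsubseteq> p"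
      using ends N(1,2,4) less_imp_le by blast+
  next
    fix x assume "x \<in> A \<inter> B"
    then show "(x, x) \<in> P \<union> N" using diag by blast
  next
    show "single_valued (P \<union> N)"
      using sv Nsv N(3) by (intro single_valuedI) blast
    show "single_valued ((P \<union> N)\<inverse>)"
      using sv' Nsv' N(5) by (intro single_valuedI) blast
  next
    fix p b x assume "(p, b) \<in> P \<union> N \<and> b \<sqsubset> x \<and> x \<sqsubset> p"
    then have "(x \<in> A \<longrightarrow> x \<in> Range P) \<and> (x \<in> B \<longrightarrow> x \<in> Domain P)"
      using inner N(6) by blast
    moreover assume "x \<in> A"
    ultimately show "x \<in> Range (P \<union> N)" by blast
  next
    fix p b x assume "(p, b) \<in> P \<union> N \<and> b \<sqsubset> x \<and> x \<sqsubset> p"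
    then have "(x \<in> A \<longrightarrow> x \<in> Range P) \<and> (x \<in> B \<longrightarrow> x \<in> Domain P)"
      using inner N(6) by blast
    moreover assume "x \<in> B"
    ultimately show "x \<in> Domain (P \<union> N)" by blast
  next
    fix p b p' b'
    assume *: "(p, b) \<in> P \<union> N \<and> (p', b') \<in> P \<union> N \<and> b \<sqsubset> b' \<and> b' \<sqsubset> p"
    have A: "b' \<in> A" and B: "p \<in> B" using * ends N(2,4) by blast+
    \<comment> \<open>A bracket inside a pair, old or new, was paired before this round; so the
      inner pair is always old.\<close>
    have "b' \<in> Range P" using * inner N(6) A by blast
    then have old': "(p', b') \<in> P" using * N(5) by blast
    show "p' \<sqsubset> p"
    proof (cases "(p, b) \<in> P")
      case True
      then show ?thesis using old' * cross by blast
    next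
      case False
      then have "p \<notin> Domain P" using * N(3) by blast
      \<comment> \<open>Otherwise the new endpoint \<open>p\<close> would lie inside the old pair
        \<open>(p', b')\<close> and be paired in \<open>P\<close>.\<close>
      then have "\<not> p \<sqsubset> p'" "p \<noteq> p'" using inner[OF old', of p] * B old' by blast+
      then show ?thesis by (meson linorder_cases)
    qed
  qed
  moreover have "pairs (Suc n) = P \<union> N" by (simp add: P_def N_def)
  ultimately show ?case by simp
qed

text \<open>The increasing rounds stay inside the finite set \<open>B \<times> A\<close>, so they
  stabilise and the limit inherits the invariant.\<close>

lemma pairing_eq_pairs: obtains N where "pairing = pairs N"
proof -
  have "pairs n \<subseteq> B \<times> A" for n
    using noncrossing_matching_pairs[of n] by (auto simp: noncrossing_matching_def)
  then have fin: "finite pairing"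
    unfolding pairing_def using finite_A finite_B
    by (meson UN_least finite_SigmaI finite_subset)
  have "\<exists>n. \<forall>x\<in>pairing. x \<in> pairs n"
    using fin
  proof (rule finite_subset_induct[where A = pairing])
    fix x F assume "x \<in> pairing" "\<exists>n. \<forall>x\<in>F. x \<in> pairs n"
    then obtain m n where "x \<in> pairs m" "F \<subseteq> pairs n"
      unfolding pairing_def by blast
    then have "insert x F \<subseteq> pairs (max m n)"
      using pairs_mono[of m "max m n"] pairs_mono[of n "max m n"] by auto
    then show "\<exists>n. \<forall>x\<in>insert x F. x \<in> pairs n" by blast
  qed auto
  then obtain N where "pairing \<subseteq> pairs N" by blast
  then have "pairing = pairs N" unfolding pairing_def by blast
  then show thesis by (rule that)
qed

text \<open>Take the first unpaired closing bracket \<open>p'\<close> after \<open>b\<close>, then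
  the last unpaired opening bracket \<open>b'\<close> before \<open>p'\<close>. All brackets between
  them are paired, so the next round would pair these two.\<close>

lemma pairing_complete:
  assumes "b \<sqsubset> p" "p \<in> B - Domain pairing" "b \<in> A - Range pairing"
  shows False
proof -
  obtain N where N: "pairing = pairs N" by (rule pairing_eq_pairs)
  define X where "X = {x \<in> B - Domain pairing. b \<sqsubset> x}"
  have "finite X" "X \<noteq> {}" using assms finite_B by (auto simp: X_def)
  then obtain p' where "p' \<in> X" and min: "\<And>x. x \<in> X \<Longrightarrow> \<not> x \<sqsubset> p'"
    using finite_has_minimal[of X] by (metis less_le)
  then have p': "p' \<in> B - Domain pairing" "b \<sqsubset> p'" by (simp_all add: X_def)
  define Y where "Y = {x \<in> A - Range pairing. x \<sqsubset> p'}"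
  have "finite Y" "b \<in> Y" using assms finite_A p' by (auto simp: Y_def)
  then obtain b' where "b' \<in> Y" and max: "\<And>x. x \<in> Y \<Longrightarrow> \<not> b' \<sqsubset> x"
    using finite_has_maximal[of Y] by (metis empty_iff less_le)
  then have b': "b' \<in> A - Range pairing" "b' \<sqsubset> p'" by (simp_all add: Y_def)
  \<comment> \<open>Brackets after \<open>b'\<close> therefore also lie after \<open>b\<close>,
    where the minimality of \<open>p'\<close> applies.\<close>
  have "b \<sqsubseteq> b'" using max[OF \<open>b \<in> Y\<close>] by simp
  have "(x \<in> A \<longrightarrow> x \<in> Range pairing) \<and> (x \<in> B \<longrightarrow> x \<in> Domain pairing)"
    if "b' \<sqsubset> x" "x \<sqsubset> p'" for x
    using min[of x] max[of x] le_less_trans[OF \<open>b \<sqsubseteq> b'\<close>] that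
    by (auto simp: X_def Y_def)
  then have "(p', b') \<in> pairs (Suc N)" using p' b' by (simp add: N)
  then have "(p', b') \<in> pairing" unfolding pairing_def by blast
  then show False using p' by blast
qed

text \<open>If \<open>p\<close> is unpaired, completeness and nesting send each opening bracket of
  an interval ending at \<open>p\<close> injectively to a closing one of the interval other than
  \<open>p\<close>. If \<open>p\<close> is paired, the interval from its partner to \<open>p\<close>
  has no surplus of closing brackets.\<close>

lemma unpaired_iff:
  assumes "p \<in> B"
  shows "p \<notin> Domain pairing \<longleftrightarrow>
    (\<forall>q. q \<sqsubseteq> p \<longrightarrow> card {x \<in> A. q \<sqsubseteq> x \<and> x \<sqsubseteq> p} < card {x \<in> B. q \<sqsubseteq> x \<and> x \<sqsubseteq> p})"
proof -
  obtain N where N: "pairing = pairs N" by (rule pairing_eq_pairs)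
  define P where "P = pairing"
  have nm: "noncrossing_matching P"
    using noncrossing_matching_pairs[of N] by (simp add: P_def N)
  note ends = noncrossing_matchingD(1)[OF nm]
    and diag = noncrossing_matchingD(2)[OF nm]
    and sv = noncrossing_matchingD(3)[OF nm]
    and sv' = noncrossing_matchingD(4)[OF nm]
    and inner = noncrossing_matchingD(5)[OF nm]
    and cross = noncrossing_matchingD(6)[OF nm]
  show ?thesis
  proof
    assume unp: "p \<notin> Domain pairing"
    show "\<forall>q. q \<sqsubseteq> p \<longrightarrow> card {x \<in> A. q \<sqsubseteq> x \<and> x \<sqsubseteq> p} < card {x \<in> B. q \<sqsubseteq> x \<and> x \<sqsubseteq> p}"
    proof (intro allI impI)
      fix q assume "q \<sqsubseteq> p"
      let ?A = "{x \<in> A. q \<sqsubseteq> x \<and> x \<sqsubseteq> p}" and ?B = "{x \<in> B. q \<sqsubseteq> x \<and> x \<sqsubseteq> p}"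
      have "\<exists>z. (z, x) \<in> P \<and> z \<in> ?B - {p}" if "x \<in> ?A" for x
      proof -
        have "x \<noteq> p" using that diag[of p] assms unp by (auto simp: P_def)
        then have "x \<sqsubset> p" using that by (simp add: less_le)
        then have "x \<in> Range P" using pairing_complete[of x p] that assms unp by (auto simp: P_def)
        then obtain z where z: "(z, x) \<in> P" by blast
        have "z \<noteq> p" using z unp by (auto simp: P_def)
        moreover have "\<not> p \<sqsubset> z" using inner[OF z \<open>x \<sqsubset> p\<close>] assms unp by (auto simp: P_def)
        ultimately have "z \<in> ?B - {p}" using ends[OF z] that by (auto intro: order_trans)
        then show ?thesis using z by blast
      qed
      then obtain f where f: "\<forall>x \<in> ?A. (f x, x) \<in> P \<and> f x \<in> ?B - {p}"
        using bchoice[of ?A "\<lambda>x z. (z, x) \<in> P \<and> z \<in> ?B - {p}"] by blast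
      have "inj_on f ?A" by (rule inj_onI) (metis f sv)
      moreover have "f ` ?A \<subseteq> ?B - {p}" using f by blast
      ultimately have "card ?A \<le> card (?B - {p})" using finite_B by (intro card_inj_on_le) auto
      also have "\<dots> < card ?B"
        using \<open>q \<sqsubseteq> p\<close> assms finite_B by (intro psubset_card_mono) auto
      finally show "card ?A < card ?B" .
    qed
  next
    assume neg: "\<forall>q. q \<sqsubseteq> p \<longrightarrow> card {x \<in> A. q \<sqsubseteq> x \<and> x \<sqsubseteq> p} < card {x \<in> B. q \<sqsubseteq> x \<and> x \<sqsubseteq> p}"
    show "p \<notin> Domain pairing"
    proof
      assume "p \<in> Domain pairing"
      then obtain b where pb: "(p, b) \<in> P" by (auto simp: P_def)
      let ?A = "{x \<in> A. b \<sqsubseteq> x \<and> x \<sqsubseteq> p}" and ?B = "{x \<in> B. b \<sqsubseteq> x \<and> x \<sqsubseteq> p}"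
      have "\<exists>x. (z, x) \<in> P \<and> x \<in> ?A" if "z \<in> ?B" for z
      proof -
        have bp: "b \<sqsubseteq> p" "b \<in> A" using ends[OF pb] by auto
        consider "z = p" | "z = b" "z \<noteq> p" | "b \<sqsubset> z" "z \<sqsubset> p"
          using \<open>z \<in> ?B\<close> unfolding less_le by blast
        then show ?thesis
        proof cases
          case 1
          then show ?thesis using pb bp by auto
        next
          case 2
          then have "(z, z) \<in> P" using diag that bp by blast
          then show ?thesis using 2 bp by auto
        next
          case 3
          then obtain x where x: "(z, x) \<in> P" using inner[OF pb] \<open>z \<in> ?B\<close> by blast
          \<comment> \<open>A partner before \<open>b\<close> would make the pair
            \<open>(z, x)\<close> cross \<open>(p, b)\<close>.\<close>
          have "\<not> x \<sqsubset> b" using cross[OF x pb] 3 by (meson less_asym)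
          then show ?thesis using x ends[OF x] 3 by (auto intro: order_trans less_imp_le)
        qed
      qed
      then obtain f where f: "\<forall>z \<in> ?B. (z, f z) \<in> P \<and> f z \<in> ?A"
        using bchoice[of ?B "\<lambda>z x. (z, x) \<in> P \<and> x \<in> ?A"] by blast
      have "inj_on f ?B" by (rule inj_onI) (metis f sv')
      then have "card ?B \<le> card ?A" using f finite_A by (intro card_inj_on_le) auto
      moreover have "card ?A < card ?B" using neg ends[OF pb] by blast
      ultimately show False by simp
    qed
  qed
qed

end

section \<open>Height functions of two adjacent rows or columns\<close>

text \<open>A lattice walk: position \<open>k\<close> is the step from \<open>k\<close> to
  \<open>Suc k\<close>, up for an opening bracket, down for a closing one, level if both or neither
  are present.\<close>

definition height :: "nat set \<Rightarrow> nat set \<Rightarrow> nat \<Rightarrow> int" where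
  "height A B k = (\<Sum>m<k. of_bool (m \<in> A) - of_bool (m \<in> B))"

lemma height_0 [simp]: "height A B 0 = 0"
  by (simp add: height_def)

lemma height_Suc:
  "height A B (Suc k) = height A B k + of_bool (k \<in> A) - of_bool (k \<in> B)"
  by (simp add: height_def)

text \<open>Turns the interval counts of the bracket criterion into comparisons of two
  heights.\<close>

lemma height_diff:
  assumes "q \<le> p"
  shows "height A B (Suc p) - height A B q =
    int (card {x \<in> A. q \<le> x \<and> x \<le> p}) - int (card {x \<in> B. q \<le> x \<and> x \<le> p})"
proof -
  have "{..<Suc p} = {..<q} \<union> {q..p}" using assms by auto
  then have "height A B (Suc p) - height A B q =
    (\<Sum>m\<in>{q..p}. of_bool (m \<in> A) - of_bool (m \<in> B))"
    by (simp add: height_def sum.union_disjoint ivl_disj_int)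
  moreover have "(\<Sum>m\<in>{q..p}. of_bool (m \<in> X)) = int (card {x \<in> X. q \<le> x \<and> x \<le> p})" for X
  proof -
    have "(\<Sum>m\<in>{q..p}. of_bool (m \<in> X)) = (\<Sum>m\<in>{q..p} \<inter> X. 1 :: int)"
      by (rule sum.mono_neutral_cong_right) auto
    moreover have "{q..p} \<inter> X = {x \<in> X. q \<le> x \<and> x \<le> p}" by auto
    ultimately show ?thesis by simp
  qed
  ultimately show ?thesis by (simp add: sum_subtractf)
qed

abbreviation row :: "nat \<Rightarrow> diagram \<Rightarrow> nat set" where
  "row r D \<equiv> {k. (r, k) \<in> D}"

abbreviation col :: "nat \<Rightarrow> diagram \<Rightarrow> nat set" where
  "col c D \<equiv> {k. (k, c) \<in> D}"

definition row_height :: "nat \<Rightarrow> diagram \<Rightarrow> nat \<Rightarrow> int" where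
  "row_height r D = height (row r D) (row (Suc r) D)"

definition col_height :: "nat \<Rightarrow> diagram \<Rightarrow> nat \<Rightarrow> int" where
  "col_height c D = height (col c D) (col (Suc c) D)"

text \<open>
  With \<open>k\<close> the selected column, \<open>Suc k\<close> is the first minimum of the row height; with \<open>s\<close> the selected
  row, \<open>s\<close> itself is the last maximum of the column height.
\<close>

definition raises :: "nat \<Rightarrow> diagram \<Rightarrow> nat \<Rightarrow> bool" where
  "raises r D k \<longleftrightarrow>
     (\<forall>q\<le>k. row_height r D (Suc k) < row_height r D q) \<and>
     (\<forall>q>k. row_height r D (Suc k) \<le> row_height r D q)"

definition rectifies :: "nat \<Rightarrow> diagram \<Rightarrow> nat \<Rightarrow> bool" where
  "rectifies c D s \<longleftrightarrow>
     (\<forall>q>s. col_height c D q < col_height c D s) \<and>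
     (\<forall>q\<le>s. col_height c D q \<le> col_height c D s)"

lemma raises_source:
  assumes "raises r D k" shows "(Suc r, k) \<in> D" "(r, k) \<notin> D"
proof -
  have "row_height r D (Suc k) < row_height r D k" using assms by (simp add: raises_def)
  then show "(Suc r, k) \<in> D" "(r, k) \<notin> D"
    by (auto simp: row_height_def height_Suc of_bool_def split: if_splits)
qed

lemma rectifies_source:
  assumes "rectifies c D s" shows "(s, Suc c) \<in> D" "(s, c) \<notin> D"
proof -
  have "col_height c D (Suc s) < col_height c D s" using assms by (simp add: rectifies_def)
  then show "(s, Suc c) \<in> D" "(s, c) \<notin> D"
    by (auto simp: col_height_def height_Suc of_bool_def split: if_splits)
qed

section \<open>The two moves and their effect on the heights\<close>

definition raise_at :: "nat \<Rightarrow> nat \<Rightarrow> diagram \<Rightarrow> diagram" where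
  "raise_at r k D = insert (r, k) (D - {(Suc r, k)})"

definition rectify_at :: "nat \<Rightarrow> nat \<Rightarrow> diagram \<Rightarrow> diagram" where
  "rectify_at c s D = insert (s, c) (D - {(s, Suc c)})"

lemma row_height_Suc:
  "row_height r D (Suc k) = row_height r D k + of_bool ((r, k) \<in> D) - of_bool ((Suc r, k) \<in> D)"
  by (simp add: row_height_def height_Suc)

lemma col_height_Suc:
  "col_height c D (Suc k) = col_height c D k + of_bool ((k, c) \<in> D) - of_bool ((k, Suc c) \<in> D)"
  by (simp add: col_height_def height_Suc)

text \<open>One step of the row walk moves from position \<open>Suc c\<close> to \<open>c\<close>,
  so only the height between them changes: up if an up step moves (\<open>s = r\<close>), down if a
  down step moves (\<open>s = Suc r\<close>).\<close>

lemma row_height_rectify_at: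
  assumes "(s, Suc c) \<in> D" "(s, c) \<notin> D"
  shows "row_height r (rectify_at c s D) q = row_height r D q +
    (if q = Suc c then of_bool (s = r) - of_bool (s = Suc r) else 0)"
proof (induction q)
  case 0
  then show ?case by (simp add: row_height_def)
next
  case (Suc q)
  have "of_bool ((t, q) \<in> rectify_at c s D) = (of_bool ((t, q) \<in> D) :: int)
      + (if s = t then of_bool (q = c) - of_bool (q = Suc c) else 0)" for t
    using assms by (cases "s = t"; cases "q = c"; cases "q = Suc c") (simp_all add: rectify_at_def)
  then show ?case unfolding row_height_Suc Suc.IH by simp
qed

lemma col_height_raise_at:
  assumes "(Suc r, k) \<in> D" "(r, k) \<notin> D"
  shows "col_height c (raise_at r k D) q = col_height c D q +
    (if q = Suc r then of_bool (k = c) - of_bool (k = Suc c) else 0)"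
proof (induction q)
  case 0
  then show ?case by (simp add: col_height_def)
next
  case (Suc q)
  have "of_bool ((q, t) \<in> raise_at r k D) = (of_bool ((q, t) \<in> D) :: int)
      + (if k = t then of_bool (q = r) - of_bool (q = Suc r) else 0)" for t
    using assms by (cases "k = t"; cases "q = r"; cases "q = Suc r") (simp_all add: raise_at_def)
  then show ?case unfolding col_height_Suc Suc.IH by simp
qed

text \<open>Only the height at \<open>Suc c\<close> changes, by at most one. The first minimum is
  displaced only if it sat there and is lifted, or sat one place later and is now tied.\<close>

lemma raises_rectify_at:
  assumes k: "raises r D k" and s: "rectifies c D s"
  shows "raises r (rectify_at c s D)
    (if s = r \<and> k = c then Suc c else if s = Suc r \<and> k = Suc c then c else k)"
proof -
  note src = raises_source[OF k] rectifies_source[OF s]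
  note R = row_height_rectify_at[OF rectifies_source[OF s], of r]
  have S: "row_height r D (Suc k) < row_height r D q" if "q \<le> k" for q
    using k that by (simp add: raises_def)
  have S': "row_height r D (Suc k) \<le> row_height r D q" for q
    using k by (meson raises_def less_imp_le not_less)
  have G: "col_height c D q < col_height c D s" if "q > s" for q
    using s that by (simp add: rectifies_def)
  have G': "col_height c D q \<le> col_height c D s" for q
    using s by (meson rectifies_def less_imp_le not_less)
  note step = row_height_Suc[of r D c] row_height_Suc[of r D "Suc c"]
    col_height_Suc[of c D r] col_height_Suc[of c D "Suc r"]
  \<comment> \<open>Cases 2 and 4 are the only ones in which the selected column changes.\<close>
  consider "s \<noteq> r" "s \<noteq> Suc r" | "s = r" "k = c" | "s = r" "k \<noteq> c"
    | "s = Suc r" "k = Suc c" | "s = Suc r" "k \<noteq> Suc c" by blast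
  then show ?thesis
  proof cases
    case 1
    then show ?thesis using k by (auto simp: raises_def R)
  next
    case 2
    \<comment> \<open>Without this cell the column height would climb back to its maximum at
      \<open>Suc (Suc r)\<close>. With it, the next row step is level, so the minimum value recurs
      at \<open>Suc (Suc c)\<close>.\<close>
    then have "(Suc r, Suc c) \<in> D"
      using step src G[of "Suc (Suc r)"] by (auto simp: of_bool_def split: if_splits)
    then have "row_height r D (Suc (Suc c)) = row_height r D (Suc k)"
      using 2 step src by simp
    then show ?thesis using 2 S S' unfolding raises_def R by (auto simp: le_Suc_eq)
  next
    case 3
    then show ?thesis using S S' unfolding raises_def R by (auto intro: add_increasing2 less_imp_le simp: add_strict_increasing2)
  next
    case 4
    \<comment> \<open>With this cell the row height at \<open>c\<close> would already equal the
      minimum.\<close>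
    then have "(r, c) \<notin> D"
      using step src S[of c] by (auto simp: of_bool_def split: if_splits)
    then have "row_height r D (Suc c) - 1 = row_height r D (Suc k)"
      using 4 step src by simp
    then show ?thesis using 4 S S' unfolding raises_def R by auto
  next
    case 5
    then have "k \<noteq> c" using src by auto
    \<comment> \<open>Maximality at \<open>Suc r\<close> shows that \<open>(r, Suc c)\<close> in
      \<open>D\<close> forces \<open>(r, c)\<close> in \<open>D\<close>. So one neighbour of
      \<open>Suc c\<close> in the row walk is lower by one, which leaves room for the
      decrease.\<close>
    have "row_height r D (Suc k) < row_height r D (Suc c) - 1" if "c < k"
      using step src S[of c] S[of "Suc c"] S[of "Suc (Suc c)"] G'[of r] that 5
      by (auto simp: of_bool_def split: if_splits)
    moreover have "row_height r D (Suc k) < row_height r D (Suc c)" if "k < c"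
      using step src S'[of c] S'[of "Suc c"] S'[of "Suc (Suc c)"] G'[of r] that 5
      by (auto simp: of_bool_def split: if_splits)
    ultimately show ?thesis using 5 S S' \<open>k \<noteq> c\<close> unfolding raises_def R by auto
  qed
qed

text \<open>The dual analysis: only the column height at \<open>Suc r\<close> changes. The last
  maximum moves up if \<open>Suc r\<close> is lifted to a tie with \<open>r\<close>, and down to
  \<open>r\<close> if it sat at \<open>Suc r\<close> and is lowered.\<close>

lemma rectifies_raise_at:
  assumes k: "raises r D k" and s: "rectifies c D s"
  shows "rectifies c (raise_at r k D)
    (if s = r \<and> k = c then Suc r else if s = Suc r \<and> k = Suc c then r else s)"
proof -
  note src = raises_source[OF k] rectifies_source[OF s]
  note R = col_height_raise_at[OF raises_source[OF k], of c]
  have S: "row_height r D (Suc k) < row_height r D q" if "q \<le> k" for q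
    using k that by (simp add: raises_def)
  have S': "row_height r D (Suc k) \<le> row_height r D q" for q
    using k by (meson raises_def less_imp_le not_less)
  have G: "col_height c D q < col_height c D s" if "q > s" for q
    using s that by (simp add: rectifies_def)
  have G': "col_height c D q \<le> col_height c D s" for q
    using s by (meson rectifies_def less_imp_le not_less)
  note step = row_height_Suc[of r D c] row_height_Suc[of r D "Suc c"]
    col_height_Suc[of c D r] col_height_Suc[of c D "Suc r"]
  consider "k \<noteq> c" "k \<noteq> Suc c" | "k = c" "s = r" | "k = c" "s \<noteq> r"
    | "k = Suc c" "s = Suc r" | "k = Suc c" "s \<noteq> Suc r" by blast
  then show ?thesis
  proof cases
    case 1
    then show ?thesis using s by (auto simp: rectifies_def R)
  next
    case 2
    then have "col_height c D (Suc r) + 1 = col_height c D s"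
      using step src by simp
    then show ?thesis using 2 G G' unfolding rectifies_def R by auto
  next
    case 3
    then have "s \<noteq> Suc r" using src by auto
    \<comment> \<open>Minimality at \<open>Suc c\<close> shows that \<open>(Suc r, Suc c)\<close> in
      \<open>D\<close> forces \<open>(r, Suc c)\<close> in \<open>D\<close>. So one neighbour of
      \<open>Suc r\<close> in the column walk is higher by one, which leaves room for the
      increase.\<close>
    have "col_height c D (Suc r) + 1 < col_height c D s" if "s < r"
      using step src G[of r] G[of "Suc r"] G[of "Suc (Suc r)"] S'[of "Suc (Suc c)"] that 3
      by (auto simp: of_bool_def split: if_splits)
    moreover have "col_height c D (Suc r) < col_height c D s" if "Suc r < s"
      using step src G'[of r] G'[of "Suc r"] G'[of "Suc (Suc r)"] S'[of "Suc (Suc c)"] that 3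
      by (auto simp: of_bool_def split: if_splits)
    ultimately show ?thesis using 3 G G' \<open>s \<noteq> Suc r\<close> unfolding rectifies_def R by auto
  next
    case 4
    then have "(r, c) \<notin> D"
      using step src S[of c] by (auto simp: of_bool_def split: if_splits)
    then have "col_height c D r = col_height c D s"
      using 4 step src by simp
    then show ?thesis using 4 G G' unfolding rectifies_def R by auto
  next
    case 5
    moreover have "col_height c D (Suc r) - 1 < col_height c D s" using G'[of "Suc r"] by simp
    ultimately show ?thesis using G G' unfolding rectifies_def R by auto
  qed
qed

text \<open>In both exceptional configurations either order inserts \<open>(r, c)\<close> and
  removes \<open>(Suc r, Suc c)\<close>. In every other case the two moves touch disjoint pairs of
  cells.\<close>

lemma raise_at_rectify_at_commute:
  assumes k: "raises r D k" and s: "rectifies c D s"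
  shows "raise_at r (if s = r \<and> k = c then Suc c else if s = Suc r \<and> k = Suc c then c else k)
      (rectify_at c s D) =
    rectify_at c (if s = r \<and> k = c then Suc r else if s = Suc r \<and> k = Suc c then r else s)
      (raise_at r k D)"
  using raises_source[OF k] rectifies_source[OF s]
  by (auto simp: raise_at_def rectify_at_def)

section \<open>The operators in terms of height functions\<close>

lemma finite_row: "finite D \<Longrightarrow> finite (row r D)"
  by (rule finite_subset[of _ "snd ` D"]) force+

lemma finite_col: "finite D \<Longrightarrow> finite (col c D)"
  by (rule finite_subset[of _ "fst ` D"]) force+

text \<open>The vertical pairing is, round by round, the image under \<open>cells\<close> of the
  bracketing in which row \<open>i\<close> opens and row \<open>i + 1\<close> closes.\<close>

lemma vert_unpaired_iff:
  assumes "finite D"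
  shows "(i + 1, c) \<in> D - matched (vert_pairing i D) \<longleftrightarrow>
    (\<forall>q\<le>c. row_height i D (Suc c) < row_height i D q)"
proof -
  interpret V: bracketing "(\<le>)" "(<)" "row i D" "row (Suc i) D"
    using finite_row[OF assms] by unfold_locales
  define cells where "cells = (\<lambda>(p, b). ((i + 1, p), (i, b)) :: cell \<times> cell)"
  have matched_cells: "(Suc i, x) \<in> matched (cells ` P) \<longleftrightarrow> x \<in> Domain P"
    "(i, x) \<in> matched (cells ` P) \<longleftrightarrow> x \<in> Range P" for x P
    by (force simp: matched_def cells_def)+
  have image_cells: "cells ` {(p, b) |p b. R p b} = {((i + 1, p), (i, b)) |b p. R p b}" for R
    by (auto simp: cells_def image_iff)
  have pairs: "vert_pairs i D n = cells ` V.pairs n" for n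
  proof (induction n)
    case 0
    show ?case by (auto simp: cells_def)
  next
    case (Suc n)
    show ?case
      unfolding vert_pairs.simps V.pairs.simps image_Un Suc.IH image_cells
      by (rule arg_cong2[where f = "(\<union>)", OF refl]) (auto simp: matched_cells)
  qed
  have less_iff: "card {x \<in> row i D. q \<le> x \<and> x \<le> c} < card {x \<in> row (Suc i) D. q \<le> x \<and> x \<le> c}
      \<longleftrightarrow> row_height i D (Suc c) < row_height i D q" if "q \<le> c" for q
    using height_diff[OF that, of "row i D" "row (Suc i) D"]
    by (simp add: row_height_def) linarith
  have "vert_pairing i D = cells ` V.pairing"
    by (simp add: vert_pairing_def V.pairing_def pairs image_UN)
  then have "(i + 1, c) \<in> D - matched (vert_pairing i D) \<longleftrightarrow>
      c \<in> row (Suc i) D \<and> c \<notin> Domain V.pairing"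
    using matched_cells by simp
  also have "\<dots> \<longleftrightarrow> c \<in> row (Suc i) D \<and> (\<forall>q\<le>c. row_height i D (Suc c) < row_height i D q)"
    using V.unpaired_iff[of c] less_iff by auto
  \<comment> \<open>Membership is absorbed: the instance \<open>q = c\<close> is a down step at
    \<open>c\<close>.\<close>
  also have "\<dots> \<longleftrightarrow> (\<forall>q\<le>c. row_height i D (Suc c) < row_height i D q)"
    using row_height_Suc[of i D c] by (auto simp: of_bool_def split: if_splits)
  finally show ?thesis .
qed

text \<open>Here opening brackets lie above their partners, so the order is reversed. The walk is
  still summed upwards, so the criterion compares \<open>r\<close> with all later positions.\<close>

lemma horiz_unpaired_iff:
  assumes "finite D"
  shows "(r, i + 1) \<in> D - matched (horiz_pairing i D) \<longleftrightarrow>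
    (\<forall>q>r. col_height i D q < col_height i D r)"
proof -
  interpret H: bracketing "(\<ge>)" "(>)" "col i D" "col (Suc i) D"
    using finite_col[OF assms] by unfold_locales auto
  define cells where "cells = (\<lambda>(p, b). ((p, i + 1), (b, i)) :: cell \<times> cell)"
  have matched_cells: "(x, Suc i) \<in> matched (cells ` P) \<longleftrightarrow> x \<in> Domain P"
    "(x, i) \<in> matched (cells ` P) \<longleftrightarrow> x \<in> Range P" for x P
    by (force simp: matched_def cells_def)+
  have image_cells: "cells ` {(p, b) |p b. R p b} = {((p, i + 1), (b, i)) |p b. R p b}" for R
    by (auto simp: cells_def image_iff)
  have pairs: "horiz_pairs i D n = cells ` H.pairs n" for n
  proof (induction n)
    case 0
    show ?case by (auto simp: cells_def)
  next
    case (Suc n)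
    show ?case
      unfolding horiz_pairs.simps H.pairs.simps image_Un Suc.IH image_cells
      by (rule arg_cong2[where f = "(\<union>)", OF refl]) (auto simp: matched_cells)
  qed
  have less_iff: "card {x \<in> col i D. x \<le> q \<and> r \<le> x} < card {x \<in> col (Suc i) D. x \<le> q \<and> r \<le> x}
      \<longleftrightarrow> col_height i D (Suc q) < col_height i D r" if "r \<le> q" for q
    using height_diff[OF that, of "col i D" "col (Suc i) D"]
    by (simp add: col_height_def conj_commute) linarith
  have "horiz_pairing i D = cells ` H.pairing"
    by (simp add: horiz_pairing_def H.pairing_def pairs image_UN)
  then have "(r, i + 1) \<in> D - matched (horiz_pairing i D) \<longleftrightarrow>
      r \<in> col (Suc i) D \<and> r \<notin> Domain H.pairing"
    using matched_cells by simp
  also have "\<dots> \<longleftrightarrow> r \<in> col (Suc i) D \<and> (\<forall>q\<ge>r. col_height i D (Suc q) < col_height i D r)"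
    using H.unpaired_iff[of r] less_iff by auto
  \<comment> \<open>The positions \<open>Suc q\<close> with \<open>q \<ge> r\<close> are exactly
    those beyond \<open>r\<close>; the first of them yields the membership.\<close>
  also have "\<dots> \<longleftrightarrow> (\<forall>q>r. col_height i D q < col_height i D r)"
    using col_height_Suc[of i D r]
    by (auto simp: of_bool_def less_eq_Suc_le split: if_splits) (metis Suc_le_D Suc_le_mono)
  finally show ?thesis .
qed

section \<open>Selected cells as extremal positions\<close>

lemma ex_new_minimum:
  fixes f :: "nat \<Rightarrow> int"
  assumes "n < j" "f j < f n" "\<And>q. q < n \<Longrightarrow> f n \<le> f q"
  shows "\<exists>u\<ge>n. \<forall>q\<le>u. f (Suc u) < f q"
proof -
  \<comment> \<open>The first later place below \<open>f n\<close> is strictly lower than everything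
    before it.\<close>
  define m where "m = (LEAST j. n < j \<and> f j < f n)"
  have m: "n < m" "f m < f n" using LeastI[of "\<lambda>j. n < j \<and> f j < f n"] assms by (simp_all add: m_def)
  have least: "f n \<le> f q" if "n < q" "q < m" for q
    using not_less_Least[of q "\<lambda>j. n < j \<and> f j < f n"] that by (simp add: m_def)
  obtain u where u: "m = Suc u" using m by (cases m) auto
  have "f (Suc u) < f q" if "q \<le> u" for q
    using that m least[of q] assms(3)[of q] u by (cases q n rule: linorder_cases) auto
  then show ?thesis using m u by (intro exI[of _ u]) auto
qed

text \<open>The set of positions with value at least \<open>g a\<close> is bounded; its largest
  element works.\<close>

lemma ex_last_maximum:
  fixes g :: "nat \<Rightarrow> int"
  assumes "\<And>q. N \<le> q \<Longrightarrow> g q < g a"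
  shows "\<exists>m. g a \<le> g m \<and> (\<forall>q>m. g q < g m)"
proof -
  let ?M = "{j. g a \<le> g j}"
  have "?M \<subseteq> {..<N}" using assms by (force simp: not_less[symmetric])
  then have fin: "finite ?M" by (rule finite_subset) simp
  then have "g a \<le> g (Max ?M)" using Max_in[of ?M] by auto
  moreover have "g q < g a" if "q > Max ?M" for q using Max_ge[OF fin, of q] that by force
  ultimately show ?thesis by force
qed

text \<open>Unpaired cells are the steps to strict record minima. The last record is the first
  global minimum, since any lower value beyond it would produce another record.\<close>

lemma raises_iff:
  "raises r D k \<longleftrightarrow>
    (\<forall>q\<le>k. row_height r D (Suc k) < row_height r D q) \<and>
    (\<forall>u. (\<forall>q\<le>u. row_height r D (Suc u) < row_height r D q) \<longrightarrow> u \<le> k)"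
    (is "_ \<longleftrightarrow> ?U k \<and> ?last")
proof
  assume k: "raises r D k"
  have "u \<le> k" if u: "?U u" for u
  proof (rule ccontr)
    assume "\<not> u \<le> k"
    then have "row_height r D (Suc u) < row_height r D (Suc k)" using u by simp
    moreover have "row_height r D (Suc k) \<le> row_height r D (Suc u)"
      using k \<open>\<not> u \<le> k\<close> by (simp add: raises_def)
    ultimately show False by simp
  qed
  then show "?U k \<and> ?last" using k by (simp add: raises_def)
next
  assume k: "?U k \<and> ?last"
  have "row_height r D (Suc k) \<le> row_height r D q" if "k < q" for q
  proof (rule ccontr)
    assume "\<not> row_height r D (Suc k) \<le> row_height r D q"
    moreover from this have "q \<noteq> Suc k" by auto
    ultimately have "\<exists>u\<ge>Suc k. ?U u"
      using k that by (intro ex_new_minimum[of _ q]) (auto simp: less_imp_le)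
    then show False using k by (meson not_less_eq_eq)
  qed
  then show "raises r D k" using k by (simp add: raises_def)
qed

lemma rectifies_iff:
  "rectifies c D s \<longleftrightarrow>
    (\<forall>q>s. col_height c D q < col_height c D s) \<and>
    (\<forall>u. (\<forall>q>u. col_height c D q < col_height c D u) \<longrightarrow> s \<le> u)"
    (is "_ \<longleftrightarrow> ?U s \<and> ?first")
proof
  assume s: "rectifies c D s"
  then show "?U s \<and> ?first" unfolding rectifies_def by (meson leD not_less less_imp_le)
next
  assume s: "?U s \<and> ?first"
  have "col_height c D q \<le> col_height c D s" if "q \<le> s" for q
  proof (rule ccontr)
    assume q: "\<not> col_height c D q \<le> col_height c D s"
    have "col_height c D p \<le> col_height c D s" if "s \<le> p" for p
      using s that by (cases "p = s") (auto simp: less_imp_le)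
    then have "col_height c D p < col_height c D q" if "s \<le> p" for p
      using q that by (meson le_less_trans not_le)
    \<comment> \<open>A value above that at \<open>s\<close> yields a position \<open>m\<close>
      dominating all later ones. The choice of \<open>s\<close> puts \<open>m\<close> at or after
      \<open>s\<close>, where no value exceeds that at \<open>s\<close>.\<close>
    then obtain m where m: "col_height c D q \<le> col_height c D m" "?U m"
      using ex_last_maximum[of s "col_height c D" q] by blast
    then have "s \<le> m" using s by blast
    then have "col_height c D m \<le> col_height c D s"
      using s by (cases "m = s") (auto simp: less_imp_le)
    then show False using m(1) q by simp
  qed
  then show "rectifies c D s" using s by (simp add: rectifies_def)
qed

lemma raising_eq_Some:
  assumes "finite D" "raises r D k"
  shows "raising r D = Some (raise_at r k D)"
proof -
  let ?U = "{c. (r + 1, c) \<in> D - matched (vert_pairing r D)}"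
  have "finite ?U" by (rule finite_subset[OF _ finite_row[OF assms(1), of "r + 1"]]) auto
  moreover have "k \<in> ?U" "\<forall>u\<in>?U. u \<le> k"
    using assms(2) unfolding vert_unpaired_iff[OF assms(1)] raises_iff by auto
  ultimately have "Max ?U = k" by (intro Max_eqI) auto
  then show ?thesis using \<open>k \<in> ?U\<close> by (auto simp: raising_def raise_at_def Let_def)
qed

lemma rectify_eq_Some:
  assumes "finite D" "rectifies c D s"
  shows "rectify c D = Some (rectify_at c s D)"
proof -
  let ?U = "{r. (r, c + 1) \<in> D - matched (horiz_pairing c D)}"
  have "finite ?U" by (rule finite_subset[OF _ finite_col[OF assms(1), of "c + 1"]]) auto
  moreover have "s \<in> ?U" "\<forall>u\<in>?U. s \<le> u"
    using assms(2) unfolding horiz_unpaired_iff[OF assms(1)] rectifies_iff by auto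
  ultimately have "Min ?U = s" by (intro Min_eqI) auto
  then show ?thesis using \<open>s \<in> ?U\<close> by (auto simp: rectify_def rectify_at_def Let_def)
qed

lemma raising_nonzero_iff_raises:
  assumes "finite D"
  shows "raising r D \<noteq> None \<longleftrightarrow> (\<exists>k. raises r D k)"
proof
  let ?U = "{c. (r + 1, c) \<in> D - matched (vert_pairing r D)}"
  assume "raising r D \<noteq> None"
  then have "?U \<noteq> {}" by (auto simp: raising_def Let_def split: if_splits)
  moreover have fin: "finite ?U"
    by (rule finite_subset[OF _ finite_row[OF assms, of "r + 1"]]) auto
  ultimately have "Max ?U \<in> ?U" "\<forall>u\<in>?U. u \<le> Max ?U" using Max_in[of ?U] by auto
  then have "raises r D (Max ?U)"
    unfolding raises_iff vert_unpaired_iff[OF assms] by blast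
  then show "\<exists>k. raises r D k" by blast
qed (auto simp: raising_eq_Some[OF assms])

lemma rectify_nonzero_iff_rectifies:
  assumes "finite D"
  shows "rectify c D \<noteq> None \<longleftrightarrow> (\<exists>s. rectifies c D s)"
proof
  let ?U = "{r. (r, c + 1) \<in> D - matched (horiz_pairing c D)}"
  assume "rectify c D \<noteq> None"
  then have "?U \<noteq> {}" by (auto simp: rectify_def Let_def split: if_splits)
  moreover have fin: "finite ?U"
    by (rule finite_subset[OF _ finite_col[OF assms, of "c + 1"]]) auto
  ultimately have "Min ?U \<in> ?U" "\<forall>u\<in>?U. Min ?U \<le> u" using Min_in[of ?U] by auto
  then have "rectifies c D (Min ?U)"
    unfolding rectifies_iff horiz_unpaired_iff[OF assms] by blast
  then show "\<exists>s. rectifies c D s" by blast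
qed (auto simp: rectify_eq_Some[OF assms])

section \<open>Preservation of nonvanishing\<close>

lemma raises_of_negative:
  assumes "finite D" "row_height r D j < 0"
  shows "\<exists>k. raises r D k"
proof -
  have "j > 0" using assms(2) by (cases j) (auto simp: row_height_def)
  \<comment> \<open>The walk starts at height \<open>0\<close>, so a negative value forces a new
    minimum after position \<open>0\<close>.\<close>
  then obtain u where "\<forall>q\<le>u. row_height r D (Suc u) < row_height r D q"
    using ex_new_minimum[of 0 j "row_height r D"] assms(2) by (auto simp: row_height_def)
  then have "(r + 1, u) \<in> D - matched (vert_pairing r D)"
    unfolding vert_unpaired_iff[OF assms(1)] .
  then have "raising r D \<noteq> None" by (auto simp: raising_def Let_def)
  then show ?thesis using raising_nonzero_iff_raises[OF assms(1)] by simp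
qed

text \<open>The eventual bound replaces a comparison with the final column height, whose value then
  never has to be computed.\<close>

lemma rectifies_of_eventually_less:
  assumes "finite D" "\<And>q. N \<le> q \<Longrightarrow> col_height c D q < col_height c D a"
  shows "\<exists>s. rectifies c D s"
proof -
  obtain m where "\<forall>q>m. col_height c D q < col_height c D m"
    using ex_last_maximum[of N "col_height c D" a] assms(2) by blast
  then have "(m, c + 1) \<in> D - matched (horiz_pairing c D)"
    unfolding horiz_unpaired_iff[OF assms(1)] .
  then have "rectify c D \<noteq> None" by (auto simp: rectify_def Let_def)
  then show ?thesis using rectify_nonzero_iff_rectifies[OF assms(1)] by simp
qed

text \<open>For the converse, a nonnegative row walk could become negative only at
  \<open>Suc c\<close>; the maximality of \<open>s\<close> excludes this.\<close>

lemma ex_raises_rectify_at_iff: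
  assumes fin: "finite D" and s: "rectifies c D s"
  shows "(\<exists>k. raises r (rectify_at c s D) k) \<longleftrightarrow> (\<exists>k. raises r D k)"
proof
  assume "\<exists>k. raises r D k"
  then show "\<exists>k. raises r (rectify_at c s D) k" using raises_rectify_at s by blast
next
  assume "\<exists>k. raises r (rectify_at c s D) k"
  then obtain k where "raises r (rectify_at c s D) k" by blast
  then have neg: "row_height r (rectify_at c s D) (Suc k) < 0"
    unfolding raises_def by (metis height_0 le0 row_height_def)
  note src = rectifies_source[OF s]
  note step = row_height_Suc[of r D c] row_height_Suc[of r D "Suc c"] col_height_Suc[of c D r]
  show "\<exists>k. raises r D k"
  proof (rule ccontr)
    assume "\<nexists>k. raises r D k"
    then have nonneg: "0 \<le> row_height r D j" for j
      using raises_of_negative[OF fin, of r j] by force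
    have "k = c" "s = Suc r" "row_height r D (Suc c) = 0"
      using neg nonneg[of "Suc k"] unfolding row_height_rectify_at[OF src]
      by (auto simp: of_bool_def split: if_splits)
    moreover have "col_height c D r \<le> col_height c D s"
      using s \<open>s = Suc r\<close> by (simp add: rectifies_def)
    \<comment> \<open>Nonnegativity at \<open>c\<close> excludes \<open>(r, c)\<close>, then
      maximality excludes \<open>(r, Suc c)\<close>, so the walk already drops to \<open>-1\<close>
      at \<open>Suc (Suc c)\<close>.\<close>
    ultimately show False
      using step src nonneg[of c] nonneg[of "Suc (Suc c)"]
      by (auto simp: of_bool_def split: if_splits)
  qed
qed

lemma ex_rectifies_raise_at_iff:
  assumes fin: "finite D" and k: "raises r D k"
  shows "(\<exists>s. rectifies c (raise_at r k D) s) \<longleftrightarrow> (\<exists>s. rectifies c D s)"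
proof
  assume "\<exists>s. rectifies c D s"
  then show "\<exists>s. rectifies c (raise_at r k D) s" using rectifies_raise_at k by blast
next
  note src = raises_source[OF k]
  note R = col_height_raise_at[OF src]
  note step = col_height_Suc[of c D r] col_height_Suc[of c D "Suc r"] row_height_Suc[of r D "Suc c"]
  assume "\<exists>s. rectifies c (raise_at r k D) s"
  then obtain a where a: "col_height c (raise_at r k D) q < col_height c (raise_at r k D) a"
    if "a < q" for q
    unfolding rectifies_def by blast
  \<comment> \<open>Beyond both \<open>a\<close> and \<open>Suc r\<close>, the only changed
    position, old and new heights agree and lie below the new maximum.\<close>
  define N where "N = max (Suc a) (Suc (Suc r))"
  have N: "col_height c D q < col_height c (raise_at r k D) a" if "N \<le> q" for q
  proof -
    have "a < q" "q \<noteq> Suc r" using that by (auto simp: N_def)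
    then show ?thesis using a[of q] unfolding R[of _ q] by simp
  qed
  show "\<exists>s. rectifies c D s"
  proof (rule ccontr)
    assume no: "\<nexists>s. rectifies c D s"
    \<comment> \<open>An old height reaching the new maximum would exceed the tail and so already
      give a last maximum of the old walk.\<close>
    have max: "col_height c D j < col_height c (raise_at r k D) a" for j
    proof (rule ccontr)
      assume "\<not> ?thesis"
      then have "col_height c D q < col_height c D j" if "N \<le> q" for q using N[OF that] by simp
      then show False using rectifies_of_eventually_less[OF fin] no by blast
    qed
    then have "a = Suc r" "k = c"
      using max[of a] unfolding R[of _ a] by (auto split: if_splits)
    then have "col_height c D j \<le> col_height c D (Suc r)" for j
      using max[of j] unfolding R[of _ a] by simp
    moreover have "row_height r D (Suc c) \<le> row_height r D (Suc (Suc c))"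
      using k \<open>k = c\<close> by (simp add: raises_def)
    \<comment> \<open>Maximality at \<open>Suc r\<close> excludes \<open>(r, Suc c)\<close>, then
      minimality at \<open>Suc c\<close> excludes \<open>(Suc r, Suc c)\<close>. The cell
      \<open>(Suc r, c)\<close> now makes the column walk rise above its maximum.\<close>
    ultimately show False using step src \<open>k = c\<close>
      by (smt (verit) of_bool_eq)
  qed
qed

theorem theorem5p33:
  fixes D :: diagram
  assumes "is_diagram D"
  shows "(\<forall>c\<ge>1. rectify c D \<noteq> None \<longrightarrow>
           (\<forall>r\<ge>1. raising r D \<noteq> None \<longleftrightarrow> Option.bind (rectify c D) (raising r) \<noteq> None))
       \<and> (\<forall>r\<ge>1. raising r D \<noteq> None \<longrightarrow>
           (\<forall>c\<ge>1. rectify c D \<noteq> None \<longleftrightarrow> Option.bind (raising r D) (rectify c) \<noteq> None))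
       \<and> (\<forall>r\<ge>1. \<forall>c\<ge>1. rectify c D \<noteq> None \<and> raising r D \<noteq> None \<longrightarrow>
           Option.bind (raising r D) (rectify c) = Option.bind (rectify c D) (raising r))"
proof -
  have fin: "finite D" using assms by (simp add: is_diagram_def)
  have fin_raise: "finite (raise_at r k D)" for r k using fin by (simp add: raise_at_def)
  have fin_rectify: "finite (rectify_at c s D)" for c s using fin by (simp add: rectify_at_def)
  show ?thesis
  proof (intro conjI allI impI)
    fix c r assume "rectify c D \<noteq> None"
    then obtain s where s: "rectifies c D s" using rectify_nonzero_iff_rectifies[OF fin] by blast
    show "raising r D \<noteq> None \<longleftrightarrow> Option.bind (rectify c D) (raising r) \<noteq> None"
      unfolding rectify_eq_Some[OF fin s] bind.simps(2) raising_nonzero_iff_raises[OF fin]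
        raising_nonzero_iff_raises[OF fin_rectify] ex_raises_rectify_at_iff[OF fin s] ..
  next
    fix r c assume "raising r D \<noteq> None"
    then obtain k where k: "raises r D k" using raising_nonzero_iff_raises[OF fin] by blast
    show "rectify c D \<noteq> None \<longleftrightarrow> Option.bind (raising r D) (rectify c) \<noteq> None"
      unfolding raising_eq_Some[OF fin k] bind.simps(2) rectify_nonzero_iff_rectifies[OF fin]
        rectify_nonzero_iff_rectifies[OF fin_raise] ex_rectifies_raise_at_iff[OF fin k] ..
  next
    fix r c assume "rectify c D \<noteq> None \<and> raising r D \<noteq> None"
    then obtain s k where s: "rectifies c D s" and k: "raises r D k"
      using raising_nonzero_iff_raises[OF fin] rectify_nonzero_iff_rectifies[OF fin] by blast
    show "Option.bind (raising r D) (rectify c) = Option.bind (rectify c D) (raising r)"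
      unfolding raising_eq_Some[OF fin k] rectify_eq_Some[OF fin s] bind.simps(2)
        raising_eq_Some[OF fin_rectify raises_rectify_at[OF k s]]
        rectify_eq_Some[OF fin_raise rectifies_raise_at[OF k s]]
        raise_at_rectify_at_commute[OF k s] ..
  qed
qed

end
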